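(* For every $n\geq 2$, $\kappa(BH_n;C_4)=n$.
   Context: The $n$-dimensional balanced hypercube $BH_n$ is the graph with vertex set $\{0,1,2,3\}^n$, vertices written $(a_0,a_1,\dots,a_{n-1})$, in which $(a_0,\dots,a_{n-1})$ is adjacent exactly to the $2n$ vertices $((a_0\pm 1)\bmod 4,a_1,\dots,a_{n-1})$ and, for each $1\le i\le n-1$, $((a_0\pm1)\bmod 4,a_1,\dots,a_{i-1},(a_i+(-1)^{a_0})\bmod 4,a_{i+1},\dots,a_{n-1})$. For a connected graph $G$ and a set $F$ of connected subgraphs of $G$, let $V(F)$ be the union of their vertex sets; $F$ is a subgraph-cut if $G-V(F)$ is disconnected or trivial. For a connected subgraph $H$ of $G$, an $H$-structure-cut is a subgraph-cut each of whose elements is isomorphic to $H$, and $\kappa(G;H)$ is the minimum cardinality of an $H$-structure-cut. $C_4$ is the cycle on four vertices. *)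

theory Defs
  imports "Graph_Theory.Graph_Theory" "HOL-Library.Extended_Nat"
begin

text \<open>
  A simple graph is a symmetric loop-free digraph (\<^locale>\<open>pair_graph\<close>): each undirected edge is
  the pair of arcs \<^term>\<open>(u, v)\<close> and \<^term>\<open>(v, u)\<close>.
\<close>

text \<open>
  A vertex \<open>(a\<^sub>0, \<dots>, a\<^sub>n\<^sub>-\<^sub>1)\<close> is a list of length \<open>n\<close>. The arcs are meaningful only for
  \<open>n \<ge> 1\<close>; for \<open>n = 0\<close> there is no coordinate \<open>a\<^sub>0\<close>.
\<close>

definition bh_verts :: "nat \<Rightarrow> int list set" where
  "bh_verts n = {a. length a = n \<and> set a \<subseteq> {0, 1, 2, 3}}"

definition bh_adj :: "nat \<Rightarrow> int list \<Rightarrow> int list \<Rightarrow> bool" where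
  "bh_adj n a b \<longleftrightarrow>
     (\<exists>s \<in> {1, -1}.
        b = a[0 := (a ! 0 + s) mod 4] \<or>
        (\<exists>i \<in> {1..<n}.
           b = a[0 := (a ! 0 + s) mod 4, i := (a ! i + (-1) ^ nat (a ! 0)) mod 4]))"

definition BH :: "nat \<Rightarrow> int list pair_pre_digraph" where
  "BH n = \<lparr> pverts = bh_verts n,
            parcs = {(a, b). a \<in> bh_verts n \<and> b \<in> bh_verts n \<and> bh_adj n a b} \<rparr>"

definition C4 :: "nat pair_pre_digraph" where
  "C4 = \<lparr> pverts = {0, 1, 2, 3},
          parcs = {(0, 1), (1, 0), (1, 2), (2, 1), (2, 3), (3, 2), (3, 0), (0, 3)} \<rparr>"

text \<open>
  The library's \<^const>\<open>connected\<close> is false for the graph without vertices, so a set \<open>F\<close> covering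
  all vertices counts as a subgraph-cut.
\<close>

definition subgraph_cut :: "'a pair_pre_digraph \<Rightarrow> 'a pair_pre_digraph set \<Rightarrow> bool" where
  "subgraph_cut G F \<longleftrightarrow>
     (\<forall>H \<in> F. pair_graph H \<and> subgraph (with_proj H) (with_proj G) \<and> connected (with_proj H)) \<and>
     (let R = with_proj G \<restriction> (pverts G - (\<Union>H \<in> F. pverts H))
      in \<not> connected R \<or> card (verts R) = 1)"

definition structure_cut ::
  "'a pair_pre_digraph \<Rightarrow> 'b pair_pre_digraph \<Rightarrow> 'a pair_pre_digraph set \<Rightarrow> bool" where
  "structure_cut G H F \<longleftrightarrow>
     subgraph_cut G F \<and> (\<forall>K \<in> F. digraph_iso (with_proj K) (with_proj H))"

text \<open>
  In \<^typ>\<open>enat\<close> the infimum of a nonempty set is attained, and it is \<open>\<infinity>\<close> if there is no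
  structure-cut at all.
\<close>

definition structure_connectivity ::
  "'a pair_pre_digraph \<Rightarrow> 'b pair_pre_digraph \<Rightarrow> enat" where
  "structure_connectivity G H = (INF F \<in> {F. finite F \<and> structure_cut G H F}. enat (card F))"

end

theory Submission
  imports Defs
begin

text \<open>
  The vertices \<open>(a\<^sub>0, a\<^sub>1, \<dots>)\<close> and \<open>(a\<^sub>0 + 2, a\<^sub>1, \<dots>)\<close> are twins: they have the same neighbours. So
  \<open>BH\<^sub>n\<close> is obtained from its quotient \<open>Q\<^sub>n\<close> by twins, an \<open>n\<close>-regular bipartite graph, by replacing
  each vertex with two nonadjacent copies.

  Upper bound: delete the \<open>n\<close> neighbour classes of a twin pair, each together with one further
  adjacent class; two adjacent classes span a 4-cycle, and the twin pair becomes isolated.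

  Lower bound: a 4-cycle contains at most two vertices of an independent set. Hence, if fewer than
  \<open>n\<close> 4-cycles are deleted, the set \<open>D\<close> of completely deleted classes contains no independent set of
  size \<open>n\<close>. This condition alone forces \<open>Q\<^sub>n - D\<close> to be connected, by induction on \<open>n\<close>, splitting
  \<open>Q\<^sub>n\<close> into the four copies of \<open>Q\<^sub>n\<^sub>-\<^sub>1\<close> with a fixed coordinate \<open>a\<^sub>1\<close>; these copies are arranged in a
  ring, consecutive ones being joined by a perfect matching.
\<close>

section \<open>The quotient by twins\<close>

text \<open>Reaching the end of the list means that no entry has moved, which is the case where only
  \<open>a_0\<close> changes. Recursion on the first entry suits the split into copies by
  \<open>a_1\<close>.\<close>

fun shifted :: "int \<Rightarrow> int list \<Rightarrow> int list \<Rightarrow> bool" where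
  "shifted s [] b \<longleftrightarrow> b = []"
| "shifted s (x # a) b \<longleftrightarrow> b = ((x + s) mod 4) # a \<or> (\<exists>c. b = x # c \<and> shifted s a c)"

definition sgn_of :: "bool \<Rightarrow> int" where
  "sgn_of p = (if p then -1 else 1)"

text \<open>
  A class of twins is encoded by the parity of \<open>a\<^sub>0\<close> (\<^const>\<open>True\<close> for odd) and the remaining
  coordinates, so \<open>Q\<^sub>n\<close> has vertex set \<open>qverts (n - 1)\<close>.
\<close>

definition qverts :: "nat \<Rightarrow> (bool \<times> int list) set" where
  "qverts m = UNIV \<times> bh_verts m"

definition qadj :: "(bool \<times> int list) rel" where
  "qadj = {((p, a), (q, b)). q = (\<not> p) \<and> shifted (sgn_of p) a b}"

definition indep_set :: "'a rel \<Rightarrow> 'a set \<Rightarrow> bool" where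
  "indep_set r I \<longleftrightarrow> (\<forall>u \<in> I. \<forall>v \<in> I. (u, v) \<notin> r)"

section \<open>Walks inside a vertex set\<close>

text \<open>The closure is reflexive outside \<open>S\<close> too, so membership in \<open>S\<close>
  has to be tracked separately.\<close>

definition reach :: "'a rel \<Rightarrow> 'a set \<Rightarrow> 'a rel" where
  "reach r S = (r \<inter> S \<times> S)\<^sup>*"

lemma reach_refl [simp]: "(u, u) \<in> reach r S"
  by (simp add: reach_def)

lemma reach_step: "(u, v) \<in> r \<Longrightarrow> u \<in> S \<Longrightarrow> v \<in> S \<Longrightarrow> (u, v) \<in> reach r S"
  by (auto simp: reach_def)

lemma reach_trans: "(u, v) \<in> reach r S \<Longrightarrow> (v, w) \<in> reach r S \<Longrightarrow> (u, w) \<in> reach r S"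
  unfolding reach_def by (rule rtrancl_trans)

lemma reach_sym:
  assumes "\<And>u v. u \<in> S \<Longrightarrow> v \<in> S \<Longrightarrow> (u, v) \<in> r \<Longrightarrow> (v, u) \<in> r"
    and "(u, v) \<in> reach r S"
  shows "(v, u) \<in> reach r S"
proof -
  have "sym (r \<inter> S \<times> S)" using assms(1) by (auto intro!: symI)
  then show ?thesis using assms(2) unfolding reach_def by (meson sym_rtrancl symD)
qed

section \<open>Counting vertices and neighbours\<close>

lemma bh_verts_0 [simp]: "bh_verts 0 = {[]}"
  by (auto simp: bh_verts_def)

lemma bh_verts_Suc: "bh_verts (Suc m) = (\<lambda>(x, a). x # a) ` ({0, 1, 2, 3} \<times> bh_verts m)"
  by (auto simp: bh_verts_def length_Suc_conv image_iff)

lemma Cons_in_bh_verts [simp]: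
  "x # a \<in> bh_verts (Suc m) \<longleftrightarrow> x \<in> {0, 1, 2, 3} \<and> a \<in> bh_verts m"
  by (auto simp: bh_verts_Suc)

lemma bh_verts_SucE:
  assumes "b \<in> bh_verts (Suc m)"
  obtains x a where "b = x # a" "x \<in> {0, 1, 2, 3}" "a \<in> bh_verts m"
  using assms by (auto simp: bh_verts_Suc)

lemma finite_bh_verts [simp]: "finite (bh_verts m)"
  by (induction m) (auto simp: bh_verts_Suc)

lemma card_bh_verts: "card (bh_verts m) = 4 ^ m"
proof (induction m)
  case (Suc m)
  have "inj_on (\<lambda>(x :: int, a). x # a) A" for A by (auto simp: inj_on_def)
  then show ?case by (simp add: bh_verts_Suc card_image card_cartesian_product Suc)
qed simp

lemma finite_qverts [simp]: "finite (qverts m)"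
  by (simp add: qverts_def)

lemma mod4_in [simp]: "(x :: int) mod 4 \<in> {0, 1, 2, 3}"
  by (auto; presburger)

lemma shifted_in_bh_verts:
  "shifted s a b \<Longrightarrow> a \<in> bh_verts m \<Longrightarrow> b \<in> bh_verts m"
proof (induction s a b arbitrary: m rule: shifted.induct)
  case (2 s x a b)
  obtain k where m: "m = Suc k" using "2.prems" by (cases m) (auto simp: bh_verts_def)
  show ?case using 2 mod4_in[of "x + s"] unfolding m by (auto simp del: mod4_in)
qed simp

lemma shifted_sym:
  "shifted s a b \<Longrightarrow> a \<in> bh_verts m \<Longrightarrow> shifted (- s) b a"
proof (induction s a b arbitrary: m rule: shifted.induct)
  case (2 s x a b)
  obtain k where m: "m = Suc k" using "2.prems" by (cases m) (auto simp: bh_verts_def)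
  have "x \<in> {0, 1, 2, 3}" using "2.prems" m by simp
  then have "((x + s) mod 4 - s) mod 4 = x" by (auto simp: mod_diff_left_eq)
  then show ?case using 2 unfolding m by auto
qed simp

text \<open>The unchanged list and the \<open>m\<close> single shifts are distinct, as 1 and -1 are
  nonzero modulo 4. This gives the degree \<open>Suc m\<close> of the quotient on
  \<open>qverts m\<close>.\<close>

lemma card_shifted:
  assumes "s \<in> {1, -1}" "a \<in> bh_verts m"
  shows "finite {b. shifted s a b}" "card {b. shifted s a b} = Suc m"
proof -
  have "finite {b. shifted s a b} \<and> card {b. shifted s a b} = Suc m" using assms(2)
  proof (induction m arbitrary: a)
    case (Suc m)
    then obtain x c where a: "a = x # c" "x \<in> {0, 1, 2, 3}" "c \<in> bh_verts m"
      by (auto elim: bh_verts_SucE)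
    have eq: "{b. shifted s a b} = insert (((x + s) mod 4) # c) ((#) x ` {b. shifted s c b})"
      using a by auto
    have "(x + s) mod 4 \<noteq> x" using assms(1) a(2) by auto
    then have "((x + s) mod 4) # c \<notin> (#) x ` {b. shifted s c b}" by auto
    then show ?case using Suc.IH[OF a(3)] by (simp add: eq card_image)
  next
    case 0
    have "{b. shifted s [] b} = {[]}" by auto
    then show ?case using 0 by simp
  qed
  then show "finite {b. shifted s a b}" "card {b. shifted s a b} = Suc m" by auto
qed

lemma sgn_of_cases: "sgn_of p \<in> {1, -1}" and sgn_of_Not [simp]: "sgn_of (\<not> p) = - sgn_of p"
  by (auto simp: sgn_of_def)

lemma qadj_iff [simp]: "((p, a), (q, b)) \<in> qadj \<longleftrightarrow> q = (\<not> p) \<and> shifted (sgn_of p) a b"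
  by (simp add: qadj_def)

lemma qadj_sym: "(u, v) \<in> qadj \<Longrightarrow> u \<in> qverts m \<Longrightarrow> (v, u) \<in> qadj"
  by (cases u, cases v) (auto simp: qverts_def dest: shifted_sym)

lemma qadj_fst: "(u, v) \<in> qadj \<Longrightarrow> fst v = (\<not> fst u)"
  by (auto simp: qadj_def)

text \<open>The quotient is bipartite with the parities as sides.\<close>

lemma indep_set_same_parity:
  assumes "\<And>u. u \<in> I \<Longrightarrow> fst u = p"
  shows "indep_set qadj I"
  using assms qadj_fst unfolding indep_set_def by metis

section \<open>Connectivity of the quotient after deletions\<close>

text \<open>Either every copy inherits the bound for one dimension less, so that copies are
  connected by induction and only have to be linked, or one copy already holds an independent
  deleted set of the maximal size \<open>Suc m\<close>.\<close>

lemma quotient_connected: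
  assumes "D \<subseteq> qverts m"
    and "\<And>I. I \<subseteq> D \<Longrightarrow> indep_set qadj I \<Longrightarrow> card I \<le> m"
    and "u \<in> qverts m - D" "v \<in> qverts m - D"
  shows "(u, v) \<in> reach qadj (qverts m - D)"
  using assms
proof (induction m arbitrary: D u v)
  case 0
  \<comment> \<open>A bound of 0 forbids even singletons; the quotient is then a single
    edge.\<close>
  have "D = {}"
  proof (rule ccontr)
    assume "D \<noteq> {}"
    then obtain d where "d \<in> D" by auto
    moreover have "indep_set qadj {d}" by (rule indep_set_same_parity[of _ "fst d"]) simp
    ultimately have "card {d} \<le> 0" by (intro "0.prems"(2)) auto
    then show False by simp
  qed
  then show ?case using "0.prems"(3,4)
    by (cases "u = v") (auto simp: qverts_def intro!: reach_step)
next
  case (Suc m)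
  define S where "S = qverts (Suc m) - D"
  define copy where "copy j = {(p, a). (p, j # a) \<in> D}" for j
  have copy_sub: "copy j \<subseteq> qverts m" for j
    using Suc.prems(1) by (auto simp: copy_def qverts_def)
  have finD: "finite D" using Suc.prems(1) by (rule finite_subset) simp
  have alpha: "card I \<le> Suc m" if "I \<subseteq> D" "indep_set qadj I" for I
    using Suc.prems(2) that by blast
  have SI: "(p, j # a) \<in> S \<longleftrightarrow> j \<in> {0, 1, 2, 3} \<and> a \<in> bh_verts m \<and> (p, j # a) \<notin> D" for p j a
    by (auto simp: S_def qverts_def)
  have SE: "\<exists>p j a. w = (p, j # a) \<and> j \<in> {0, 1, 2, 3} \<and> a \<in> bh_verts m \<and> (p, j # a) \<notin> D"
    if "w \<in> S" for w
    using that by (cases w) (auto simp: S_def qverts_def elim!: bh_verts_SucE)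
  have trans: "(w, w') \<in> reach qadj S \<Longrightarrow> (w', w'') \<in> reach qadj S \<Longrightarrow> (w, w'') \<in> reach qadj S"
    for w w' w''
    by (rule reach_trans)
  have sym: "(w, w') \<in> reach qadj S \<Longrightarrow> (w', w) \<in> reach qadj S" for w w'
    by (rule reach_sym[of S qadj]) (auto simp: S_def intro: qadj_sym)
  have lift: "((p, j # a), (q, j # b)) \<in> reach qadj S"
    if "((p, a), (q, b)) \<in> reach qadj (qverts m - copy j)" and j: "j \<in> {0, 1, 2, 3}"
    for p a q b j
    using that(1) unfolding reach_def
  proof (induction rule: rtrancl_induct2)
    case (step p' a' q' b')
    have "((p', j # a'), (q', j # b')) \<in> qadj \<inter> S \<times> S"
      using step(2) j by (auto simp: SI copy_def qverts_def)
    then show ?case using step(3) by (rule rtrancl_into_rtrancl[rotated])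
  qed simp
  \<comment> \<open>Counting contradiction for the second case: a deleted class for each of
    \<open>Suc m\<close> neighbours, plus one further class \<open>e\<close>, exceeds the
    independence bound by one.\<close>
  have saturated: False
    if a: "a \<in> bh_verts m" and N: "N = {b. shifted (sgn_of p) a b}" and "inj_on f N" "f ` N \<subseteq> D"
      "e \<in> D" "e \<notin> f ` N" "indep_set qadj (insert e (f ` N))"
    for a p N and f :: "int list \<Rightarrow> bool \<times> int list" and e
  proof -
    have "finite N" "card N = Suc m" using card_shifted[OF sgn_of_cases a] N by auto
    then have "card (insert e (f ` N)) = Suc (Suc m)" using that by (simp add: card_image)
    moreover have "card (insert e (f ` N)) \<le> Suc m" using that by (intro alpha) auto
    ultimately show False by simp
  qed
  have "(u, v) \<in> reach qadj S"
  proof (cases "\<forall>j \<in> {0, 1, 2, 3}. \<forall>I. I \<subseteq> copy j \<longrightarrow> indep_set qadj I \<longrightarrow> card I \<le> m")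
    case True
    have conn: "((p, j # a), (q, j # b)) \<in> reach qadj S"
      if "(p, j # a) \<in> S" "(q, j # b) \<in> S" for p q j a b
    proof (rule lift)
      show j: "j \<in> {0, 1, 2, 3}" using that by (simp add: SI)
      show "((p, a), (q, b)) \<in> reach qadj (qverts m - copy j)"
      proof (rule Suc.IH[OF copy_sub])
        show "card I \<le> m" if "I \<subseteq> copy j" "indep_set qadj I" for I
          using True j that by blast
      qed (use that in \<open>auto simp: SI copy_def qverts_def\<close>)
    qed
    \<comment> \<open>One deleted end from each edge of a blocked matching would give \<open>4 ^ m\<close> independent classes.\<close>
    have link: "\<exists>a. (False, j # a) \<in> S \<and> (True, ((j + 1) mod 4) # a) \<in> S"
      if j: "j \<in> {0, 1, 2, 3}" for j
    proof (rule ccontr)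
      assume none: "\<not> ?thesis"
      define f where
        "f a = (if (False, j # a) \<in> D then (False, j # a) else (True, ((j + 1) mod 4) # a))" for a
      have fD: "f a \<in> D" if "a \<in> bh_verts m" for a
        using none that j mod4_in[of "j + 1"] by (auto simp: f_def SI simp del: mod4_in)
      have j1: "j \<noteq> (j + 1) mod 4" using j by auto
      have "inj_on f (bh_verts m)" by (auto simp: inj_on_def f_def split: if_splits)
      then have "card (f ` bh_verts m) = 4 ^ m" by (simp add: card_image card_bh_verts)
      \<comment> \<open>Classes of opposite parity chosen here are adjacent only along a matching
        edge, and \<open>f\<close> keeps one end of each edge.\<close>
      moreover have "indep_set qadj (f ` bh_verts m)"
        using j1 j1[symmetric] by (auto simp: indep_set_def f_def sgn_of_def split: if_splits)
      ultimately have le: "4 ^ m \<le> Suc m" using alpha[of "f ` bh_verts m"] fD by auto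
      have "Suc k < 4 ^ k" if "k > 0" for k :: nat
        using that by (induction k rule: nat_induct_non_zero) auto
      with le have m: "m = 0" by (metis not_gr_zero not_less)
      \<comment> \<open>For \<open>m = 0\<close> the count gives no contradiction, but one deleted
        class already violates the bound 0 of its copy.\<close>
      obtain p i where fp: "f [] = (p, [i])" "i \<in> {0, 1, 2, 3}"
        using j mod4_in[of "j + 1"] that[of False j] that[of True "(j + 1) mod 4"]
        unfolding f_def by metis
      have "indep_set qadj {(p, [])}" by (rule indep_set_same_parity[of _ p]) simp
      moreover have "{(p, [])} \<subseteq> copy i" using fD[of "[]"] m fp by (simp add: copy_def)
      ultimately have "card {(p, [] :: int list)} \<le> m" using True fp(2) by blast
      then show False using m by simp
    qed
    have next_copy: "\<exists>q b. ((p, j # a), (q, ((j + 1) mod 4) # b)) \<in> reach qadj S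
        \<and> (q, ((j + 1) mod 4) # b) \<in> S"
      if w: "(p, j # a) \<in> S" for p j a
    proof -
      have "j \<in> {0, 1, 2, 3}" using w by (simp add: SI)
      from link[OF this] obtain c where c: "(False, j # c) \<in> S" "(True, ((j + 1) mod 4) # c) \<in> S"
        by auto
      have "((False, j # c), (True, ((j + 1) mod 4) # c)) \<in> reach qadj S"
        using c by (intro reach_step) (auto simp: sgn_of_def)
      then show ?thesis using conn[OF w c(1)] c(2) trans by metis
    qed
    \<comment> \<open>Always moving one copy upward reaches copy 0 in at most three moves, since 3 +
      1 is 0 modulo 4.\<close>
    have to_0: "\<exists>q b. (w, (q, 0 # b)) \<in> reach qadj S \<and> (q, 0 # b) \<in> S" if "w \<in> S" for w
    proof -
      have from_3: "\<exists>q b. ((p, 3 # a), (q, 0 # b)) \<in> reach qadj S \<and> (q, 0 # b) \<in> S"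
        if "(p, 3 # a) \<in> S" for p a
        using next_copy[OF that] by simp
      have from_2: "\<exists>q b. ((p, 2 # a), (q, 0 # b)) \<in> reach qadj S \<and> (q, 0 # b) \<in> S"
        if "(p, 2 # a) \<in> S" for p a
        using next_copy[OF that] from_3 trans by simp blast
      have from_1: "\<exists>q b. ((p, 1 # a), (q, 0 # b)) \<in> reach qadj S \<and> (q, 0 # b) \<in> S"
        if "(p, 1 # a) \<in> S" for p a
        using next_copy[OF that] from_2 trans by simp blast
      obtain p j a where "w = (p, j # a)" "j \<in> {0, 1, 2, 3}" using SE[OF \<open>w \<in> S\<close>] by blast
      then consider "w = (p, 0 # a)" | "w = (p, 1 # a)" | "w = (p, 2 # a)" | "w = (p, 3 # a)" by auto
      then show ?thesis
        using \<open>w \<in> S\<close> from_1[of p a] from_2[of p a] from_3[of p a] reach_refl[of w qadj S]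
        by cases blast+
    qed
    have "u \<in> S" "v \<in> S" using Suc.prems(3,4) by (simp_all add: S_def)
    then obtain p a q b where "(u, (p, 0 # a)) \<in> reach qadj S" "(p, 0 # a) \<in> S"
      "(v, (q, 0 # b)) \<in> reach qadj S" "(q, 0 # b) \<in> S"
      using to_0[of u] to_0[of v] by blast
    then show ?thesis using trans[OF trans[OF _ conn] sym] by blast
  next
    case False
    then obtain j I where j: "j \<in> {0, 1, 2, 3}" and I: "I \<subseteq> copy j" "indep_set qadj I" "card I > m"
      by (auto simp: not_le)
    define far where "far = (j + 2) mod 4"
    define I' where "I' = (\<lambda>(p, a). (p, j # a)) ` I"
    \<comment> \<open>Copy \<open>j\<close> exhausts the independence bound and copy \<open>far\<close> has no neighbours in it, so nothing is
      deleted from copy \<open>far\<close>; it remains to reach that copy from everywhere.\<close>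
    have far: "far \<in> {0, 1, 2, 3}" "far \<noteq> j" "(j + sgn_of p) mod 4 \<noteq> far"
      "(far + sgn_of p) mod 4 \<noteq> j" for p
      using j by (auto simp: far_def sgn_of_def)
    have I'D: "I' \<subseteq> D" using I(1) by (auto simp: I'_def copy_def)
    have "inj_on (\<lambda>(p, a). (p, j # a)) I" by (auto simp: inj_on_def)
    then have cI': "card I' > m" using I(3) by (simp add: I'_def card_image)
    then have "I' \<noteq> {}" by auto
    then obtain d where d: "d \<in> I'" by blast
    have shifted_ne: "(j + sgn_of p) mod 4 \<noteq> j" for p
      using j by (auto simp: sgn_of_def)
    have indI': "indep_set qadj I'"
      using I(2) shifted_ne shifted_ne[symmetric]
      by (fastforce simp: indep_set_def I'_def)
    have farD: "(p, far # a) \<notin> D" for p a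
    proof
      assume pD: "(p, far # a) \<in> D"
      have "indep_set qadj (insert (p, far # a) I')"
        using indI' far far(2-4)[symmetric] shifted_ne[of p]
        by (auto simp: indep_set_def I'_def)
      then have "card (insert (p, far # a) I') \<le> Suc m" using pD I'D by (intro alpha) auto
      moreover have "(p, far # a) \<notin> I'" using far(2) by (auto simp: I'_def)
      moreover have "finite I'" using I'D finD finite_subset by blast
      ultimately show False using cI' by simp
    qed
    have conn: "((p, far # a), (q, far # b)) \<in> reach qadj S"
      if "a \<in> bh_verts m" "b \<in> bh_verts m" for p q a b
    proof (rule lift[OF _ far(1)])
      have "copy far = {}" using farD by (auto simp: copy_def)
      then show "((p, a), (q, b)) \<in> reach qadj (qverts m - copy far)"
        using that by (intro Suc.IH) (auto simp: qverts_def)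
    qed
    \<comment> \<open>A class can leave its copy in one direction only, fixed by its parity. If that
      direction is not towards \<open>far\<close>, a step inside copy \<open>k\<close> first flips
      the parity.\<close>
    have near: "\<exists>q b. ((p, k # a), (q, far # b)) \<in> reach qadj S \<and> b \<in> bh_verts m"
      if w: "(p, k # a) \<in> S" and k: "k = (j + t) mod 4" "t \<in> {1, -1}" for p k a t
    proof (cases "sgn_of p = t")
      case True
      have "(k + t) mod 4 = far" using k j by (auto simp: far_def)
      then have "((p, k # a), (\<not> p, far # a)) \<in> reach qadj S"
        using w farD far(1) True by (intro reach_step) (auto simp: SI)
      then show ?thesis using w by (auto simp: SI)
    next
      case False
      then have t: "sgn_of p = - t" using k(2) sgn_of_cases[of p] by auto
      define N where "N = {b. shifted (sgn_of p) a b}"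
      have a: "a \<in> bh_verts m" and k': "k \<in> {0, 1, 2, 3}" using w by (auto simp: SI)
      have "\<exists>b \<in> N. (\<not> p, k # b) \<notin> D"
      proof (rule ccontr)
        assume all: "\<not> ?thesis"
        have kj: "k \<noteq> j" using k j by auto
        have nadj: "(j - t) mod 4 \<noteq> k" "(k + t) mod 4 \<noteq> j" using k j by auto
        obtain q c where qc: "d = (q, j # c)" using d by (auto simp: I'_def)
        \<comment> \<open>Classes of parity \<open>\<not> p\<close> in copy \<open>k\<close> leave
          towards \<open>far\<close>, so none is adjacent to \<open>d\<close> in copy
          \<open>j\<close>.\<close>
        show False
        proof (rule saturated[OF a N_def, of "\<lambda>b. (\<not> p, k # b)" d])
          show "indep_set qadj (insert d ((\<lambda>b. (\<not> p, k # b)) ` N))"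
            using kj nadj kj[symmetric] nadj[symmetric] t unfolding qc
            by (cases p; cases q) (auto simp: indep_set_def sgn_of_def)
        qed (use all d I'D kj qc in \<open>auto simp: inj_on_def\<close>)
      qed
      then obtain b where b: "shifted (sgn_of p) a b" "(\<not> p, k # b) \<notin> D" by (auto simp: N_def)
      have bv: "b \<in> bh_verts m" using b(1) a by (rule shifted_in_bh_verts)
      have "((p, k # a), (\<not> p, k # b)) \<in> reach qadj S"
        using w b bv k' by (intro reach_step) (auto simp: SI)
      moreover have "(k + t) mod 4 = far" using k j by (auto simp: far_def)
      then have "((\<not> p, k # b), (p, far # b)) \<in> reach qadj S"
        using w farD far(1) t b bv k' by (intro reach_step) (auto simp: SI)
      ultimately show ?thesis using bv trans by metis
    qed
    \<comment> \<open>There are \<open>Suc (Suc m)\<close> ways out of copy \<open>j\<close>: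
      directly to \<open>out\<close>, or through a neighbour \<open>(\<not> p, j # b)\<close> and
      its own exit on the other side. If all are blocked, \<open>f b\<close> is a deleted class on
      the route through \<open>b\<close>.\<close>
    have escape: "\<exists>q k b t. ((p, j # a), (q, k # b)) \<in> reach qadj S \<and> (q, k # b) \<in> S
        \<and> k = (j + t) mod 4 \<and> t \<in> {1, -1}"
      if w: "(p, j # a) \<in> S" for p a
    proof (rule ccontr)
      assume none: "\<not> ?thesis"
      define s where "s = sgn_of p"
      have s: "s \<in> {1, -1}" "- s \<in> {1, -1}" using sgn_of_cases[of p] by (auto simp: s_def)
      define out where "out = (\<not> p, ((j + s) mod 4) # a)"
      have a: "a \<in> bh_verts m" using w by (simp add: SI)
      define N where "N = {b. shifted (sgn_of p) a b}"
      define f where "f b = (if (\<not> p, j # b) \<in> D then (\<not> p, j # b) else (p, ((j - s) mod 4) # b))" for b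
      have outD: "out \<in> D"
      proof (rule ccontr)
        assume "out \<notin> D"
        then have "out \<in> S" using a mod4_in[of "j + s"] by (auto simp: out_def SI simp del: mod4_in)
        moreover from this have "((p, j # a), out) \<in> reach qadj S"
          using w by (intro reach_step) (auto simp: out_def s_def)
        ultimately show False using none s unfolding out_def by blast
      qed
      have fD: "f b \<in> D" if "b \<in> N" for b
      proof (rule ccontr)
        assume "f b \<notin> D"
        then have nD: "(\<not> p, j # b) \<notin> D" "(p, ((j - s) mod 4) # b) \<notin> D"
          by (auto simp: f_def split: if_splits)
        have bv: "b \<in> bh_verts m" using that a by (auto simp: N_def intro: shifted_in_bh_verts)
        have S: "(\<not> p, j # b) \<in> S" "(p, ((j - s) mod 4) # b) \<in> S"
          using nD bv j mod4_in[of "j - s"] by (auto simp: SI simp del: mod4_in)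
        have "((p, j # a), (\<not> p, j # b)) \<in> reach qadj S"
          using w S that by (intro reach_step) (auto simp: N_def)
        moreover have "((\<not> p, j # b), (p, ((j - s) mod 4) # b)) \<in> reach qadj S"
          using S by (intro reach_step) (auto simp: s_def)
        ultimately have "((p, j # a), (p, ((j + - s) mod 4) # b)) \<in> reach qadj S"
          using trans by (metis diff_conv_add_uminus)
        then show False using none s S(2) by (metis diff_conv_add_uminus)
      qed
      have ne: "(j + s) mod 4 \<noteq> j" "(j - s) mod 4 \<noteq> j" "(j + s) mod 4 \<noteq> (j - s) mod 4"
        "((j + s) mod 4 - s) mod 4 = j" "((j - s) mod 4 + s) mod 4 = j"
        using s j by auto
      show False
      proof (rule saturated[OF a N_def, of f out])
        show "f ` N \<subseteq> D" using fD by blast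
        show "indep_set qadj (insert out (f ` N))"
          unfolding indep_set_def
        proof (intro ballI)
          have sp: "sgn_of p = s" by (simp add: s_def)
          note ne' = ne(1-3) ne(1-3)[symmetric]
          \<comment> \<open>\<open>f b\<close> either has the parity of \<open>out\<close> or lies
            in the copy opposite to it.\<close>
          have 1: "(out, f b) \<notin> qadj" "(f b, out) \<notin> qadj" "(out, out) \<notin> qadj" for b
            unfolding out_def f_def using ne' by (simp_all add: sp ne(4,5) del: mod_add_left_eq mod_diff_left_eq)
          \<comment> \<open>An adjacent pair would be a neighbour in copy \<open>j\<close> and its
            own exit, but \<open>f\<close> takes only one of the two.\<close>
          have 2: "(f b, f b') \<notin> qadj" for b b'
            unfolding f_def using ne' by (auto simp: sp ne(4,5) simp del: mod_add_left_eq mod_diff_left_eq)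
          fix x y
          assume "x \<in> insert out (f ` N)" "y \<in> insert out (f ` N)"
          then show "(x, y) \<notin> qadj" using 1 2 by blast
        qed
      qed (use outD ne(1) in \<open>auto simp: inj_on_def f_def out_def split: if_splits\<close>)
    qed
    have to_far: "\<exists>q b. (w, (q, far # b)) \<in> reach qadj S \<and> b \<in> bh_verts m" if wS: "w \<in> S" for w
    proof -
      obtain p k a where w: "w = (p, k # a)" "k \<in> {0, 1, 2, 3}" "a \<in> bh_verts m"
        using SE[OF wS] by blast
      consider "k = far" | "k = j" | "k = (j + 1) mod 4" | "k = (j + -1) mod 4"
        using w(2) j by (auto simp: far_def)
      then show ?thesis
      proof cases
        case 1
        then show ?thesis using w reach_refl[of w qadj S] by metis
      next
        case 2
        then obtain q l b t where l: "(w, (q, l # b)) \<in> reach qadj S" "(q, l # b) \<in> S"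
          "l = (j + t) mod 4" "t \<in> {1, -1}"
          using escape[of p a] wS w(1) by blast
        from near[OF l(2-4)] show ?thesis using trans[OF l(1)] by blast
      next
        case 3
        then show ?thesis using near[of p k a 1] wS w by blast
      next
        case 4
        then show ?thesis using near[of p k a "-1"] wS w by blast
      qed
    qed
    have "u \<in> S" "v \<in> S" using Suc.prems(3,4) by (simp_all add: S_def)
    then obtain p a q b where "(u, (p, far # a)) \<in> reach qadj S" "a \<in> bh_verts m"
      "(v, (q, far # b)) \<in> reach qadj S" "b \<in> bh_verts m"
      using to_far[of u] to_far[of v] by blast
    then show ?thesis using trans[OF trans[OF _ conn] sym] by blast
  qed
  then show ?case by (simp add: S_def)
qed

section \<open>From twin classes back to the balanced hypercube\<close>

definition cls :: "int list \<Rightarrow> bool \<times> int list" where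
  "cls a = (odd (hd a), tl a)"

lemma cls_Cons [simp]: "cls (x # a) = (odd x, a)"
  by (simp add: cls_def)

lemma shifted_iff:
  "shifted s a b \<longleftrightarrow> b = a \<or> (\<exists>k < length a. b = a[k := (a ! k + s) mod 4])"
proof (induction a arbitrary: b)
  case (Cons x a)
  show ?case by (auto simp: Cons Ex_less_Suc2)
qed simp

text \<open>Modulo 4, adding 1 or -1 to \<open>a_0\<close> reaches exactly the values of the other
  parity, so adjacency depends on the classes alone.\<close>

lemma bh_adj_iff:
  assumes "a \<in> bh_verts (Suc m)" "b \<in> bh_verts (Suc m)"
  shows "bh_adj (Suc m) a b \<longleftrightarrow> (cls a, cls b) \<in> qadj"
proof -
  obtain x c where a: "a = x # c" "x \<in> {0, 1, 2, 3}" "c \<in> bh_verts m"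
    using assms(1) by (rule bh_verts_SucE)
  obtain y d where b: "b = y # d" "y \<in> {0, 1, 2, 3}" "d \<in> bh_verts m"
    using assms(2) by (rule bh_verts_SucE)
  have len: "length c = m" using a(3) by (simp add: bh_verts_def)
  have sgn: "(-1) ^ nat x = sgn_of (odd x)" using a(2) by (auto simp: sgn_of_def)
  have par: "(\<exists>s \<in> {1, -1}. y = (x + s) mod 4) \<longleftrightarrow> odd y = (\<not> odd x)"
    using a(2) b(2) by (elim insertE emptyE) simp_all
  have index: "(\<exists>i \<in> {1..<Suc m}. P i) \<longleftrightarrow> (\<exists>k < m. P (Suc k))" for P
    unfolding Bex_def by (metis One_nat_def Suc_le_D Suc_le_mono Suc_less_eq atLeastLessThan_iff le0)
  have "bh_adj (Suc m) a b \<longleftrightarrow> (\<exists>s \<in> {1, -1}. y = (x + s) mod 4)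
      \<and> (d = c \<or> (\<exists>k < m. d = c[k := (c ! k + sgn_of (odd x)) mod 4]))"
    unfolding bh_adj_def index a(1) b(1) by (auto simp: sgn)
  also have "\<dots> \<longleftrightarrow> (cls a, cls b) \<in> qadj"
    unfolding par a(1) b(1) by (simp add: shifted_iff len)
  finally show ?thesis .
qed

lemma pverts_BH [simp]: "pverts (BH n) = bh_verts n"
  by (simp add: BH_def)

lemma parcs_BH:
  "parcs (BH (Suc m)) = {(a, b). a \<in> bh_verts (Suc m) \<and> b \<in> bh_verts (Suc m) \<and> (cls a, cls b) \<in> qadj}"
  by (auto simp: BH_def bh_adj_iff)

lemma cls_in_qverts: "a \<in> bh_verts (Suc m) \<Longrightarrow> cls a \<in> qverts m"
  by (auto simp: qverts_def elim: bh_verts_SucE)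

lemma sym_parcs_BH: "sym (parcs (BH (Suc m)))"
  by (auto simp: parcs_BH intro!: symI dest: qadj_sym cls_in_qverts)

lemma symcl_sym: "sym r \<Longrightarrow> r\<^sup>s = r"
  by (auto simp: symcl_def dest: symD)

text \<open>The library defines connectedness through the symmetric closure, which changes nothing
  for symmetric arcs.\<close>

lemma connected_induce_iff:
  assumes "sym (parcs G)"
  shows "connected (with_proj G \<restriction> S) \<longleftrightarrow>
    S \<noteq> {} \<and> (\<forall>u \<in> S. \<forall>v \<in> S. (u, v) \<in> reach (parcs G) S)"
proof -
  have arcs: "arcs_ends (with_proj G \<restriction> S) = parcs G \<inter> S \<times> S"
    by (auto simp: arcs_ends_conv induce_subgraph_def image_iff)
  have "sym (parcs G \<inter> S \<times> S)" using assms by (auto intro!: symI dest: symD)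
  then have cl: "(parcs G \<inter> S \<times> S)\<^sup>s = parcs G \<inter> S \<times> S" by (rule symcl_sym)
  have "(u, v) \<in> rtrancl_on S (parcs G \<inter> S \<times> S) \<longleftrightarrow> (u, v) \<in> reach (parcs G) S"
    if "u \<in> S" "v \<in> S" for u v
    using that unfolding reach_def
    by (auto intro: rtrancl_on_rtranclI rtrancl_consistent_rtrancl_on)
  then show ?thesis unfolding connected_conv arcs cl by simp
qed

section \<open>The lower bound\<close>

text \<open>The isomorphism maps \<open>J\<close> onto an independent set of \<open>C4\<close>,
  which lies in one of the diagonals {0, 2} and {1, 3}.\<close>

lemma indep_set_C4_card_le:
  assumes "digraph_iso (with_proj K) (with_proj C4)" "J \<subseteq> pverts K" "indep_set (parcs K) J"
  shows "card J \<le> 2"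
proof -
  obtain f where iso: "pre_digraph.digraph_isomorphism (with_proj K) f"
    and C4: "with_proj C4 = app_iso f (with_proj K)"
    using assms(1) by (auto simp: digraph_iso_def)
  have inj: "inj_on (iso_verts f) J"
    using iso assms(2) by (auto simp: pre_digraph.digraph_isomorphism_def intro: inj_on_subset)
  have ends: "iso_tail f = fst" "iso_head f = snd"
    using arg_cong[OF C4, of tail] arg_cong[OF C4, of head] by simp_all
  have arcs: "iso_arcs f ` parcs K = parcs C4" using arg_cong[OF C4, of arcs] by simp
  have verts: "iso_verts f ` pverts K = {0, 1, 2, 3}"
    using arg_cong[OF C4, of verts] by (simp add: C4_def)
  define T where "T = iso_verts f ` J"
  have T: "T \<subseteq> {0, 1, 2, 3}" using image_mono[OF assms(2), of "iso_verts f"] verts by (simp add: T_def)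
  have indep: False if ij: "(i, j) \<in> parcs C4" "i \<in> T" "j \<in> T" for i j
  proof -
    have "(i, j) \<in> iso_arcs f ` parcs K" using ij(1) by (simp only: arcs)
    then obtain e where e: "e \<in> parcs K" "iso_arcs f e = (i, j)" by force
    have wf: "pair_wf_digraph K"
      using iso by (simp add: pre_digraph.digraph_isomorphism_def wf_digraph_wp_iff)
    \<comment> \<open>Tail and head in \<open>C4\<close> are the projections, so the ends of
      \<open>e\<close> are mapped to \<open>i\<close> and \<open>j\<close>.\<close>
    have v: "iso_verts f (fst e) = i" "iso_verts f (snd e) = j"
      using iso e ends by (auto simp: pre_digraph.digraph_isomorphism_def)
    have "fst e \<in> pverts K" "snd e \<in> pverts K"
      using wf e(1) by (auto dest: pair_wf_digraph.arc_fst_in_verts pair_wf_digraph.arc_snd_in_verts)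
    moreover obtain x y where "x \<in> J" "y \<in> J" "iso_verts f x = i" "iso_verts f y = j"
      using ij(2,3) by (auto simp: T_def)
    ultimately have "fst e \<in> J" "snd e \<in> J"
      using v iso assms(2) unfolding pre_digraph.digraph_isomorphism_def with_proj_simps
      by (metis inj_onD subsetD)+
    then show False using assms(3) e(1) unfolding indep_set_def by (metis prod.collapse)
  qed
  have "T \<subseteq> {0, 2} \<or> T \<subseteq> {1, 3}"
  proof (cases "0 \<in> T \<or> 2 \<in> T")
    case True
    then have "1 \<notin> T" "3 \<notin> T"
      using indep[of 0 1] indep[of 2 1] indep[of 0 3] indep[of 2 3] by (auto simp: C4_def)
    then show ?thesis using T by blast
  qed (use T in blast)
  then have "card T \<le> 2"
    using card_mono[of "{0, 2 :: nat}" T] card_mono[of "{1, 3 :: nat}" T] by auto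
  then show ?thesis using inj by (simp add: T_def card_image)
qed

text \<open>\<open>D\<close> collects the classes that lose both twins. A class outside
  \<open>D\<close> keeps a member, so walks avoiding \<open>D\<close> lift to the remaining
  graph.\<close>

lemma structure_cut_C4_BH_card_ge:
  assumes "finite F" "structure_cut (BH (Suc m)) C4 F"
  shows "card F \<ge> Suc m"
proof (rule ccontr)
  assume "\<not> ?thesis"
  then have F: "card F \<le> m" by simp
  let ?V = "bh_verts (Suc m)" and ?E = "parcs (BH (Suc m))"
  define U where "U = (\<Union>K \<in> F. pverts K)"
  define S where "S = ?V - U"
  define D where "D = {q \<in> qverts m. \<forall>a \<in> ?V. cls a = q \<longrightarrow> a \<in> U}"
  have lift: "\<exists>a \<in> S. cls a = q" if "q \<in> qverts m - D" for q
    using that by (auto simp: D_def S_def)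
  have clsS: "cls a \<in> qverts m - D" if "a \<in> S" for a
    using that cls_in_qverts by (auto simp: D_def S_def)
  have alpha: "card I \<le> m" if I: "I \<subseteq> D" "indep_set qadj I" for I
  proof -
    \<comment> \<open>The values 0 and 1 of \<open>c\<close> give the two twins of a class, so
      \<open>J\<close> is an independent set with twice the size of \<open>I\<close>.\<close>
    define g where "g = (\<lambda>(c :: int, p, a). ((if p then 1 else 0) + 2 * c) # a)"
    define J where "J = g ` ({0, 1} \<times> I)"
    have "inj_on g ({0, 1} \<times> I)" by (auto simp: inj_on_def g_def split: if_splits)
    then have cJ: "card J = 2 * card I" by (simp add: J_def card_image card_cartesian_product)
    have cls_J: "cls a \<in> I" "a \<in> ?V" if "a \<in> J" for a
      using that I(1) by (auto simp: J_def g_def D_def qverts_def)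
    have "J \<subseteq> U" using cls_J I(1) by (auto simp: D_def)
    then have "J = (\<Union>K \<in> F. J \<inter> pverts K)" by (auto simp: U_def)
    then have "card J \<le> (\<Sum>K \<in> F. card (J \<inter> pverts K))"
      using card_UN_le[OF assms(1)] by metis
    also have "\<dots> \<le> (\<Sum>K \<in> F. 2)"
    proof (rule sum_mono)
      fix K assume "K \<in> F"
      then have iso: "digraph_iso (with_proj K) (with_proj C4)"
        and sub: "subgraph (with_proj K) (with_proj (BH (Suc m)))"
        using assms(2) by (auto simp: structure_cut_def subgraph_cut_def)
      have "parcs K \<subseteq> ?E" using sub by (simp add: subgraph_def)
      then have "indep_set (parcs K) (J \<inter> pverts K)"
        using I(2) cls_J by (fastforce simp: indep_set_def parcs_BH)
      then show "card (J \<inter> pverts K) \<le> 2" by (intro indep_set_C4_card_le[OF iso]) auto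
    qed
    also have "\<dots> \<le> 2 * m" using F by simp
    finally show ?thesis using cJ by simp
  qed
  \<comment> \<open>The \<open>Suc m\<close> neighbours of a class share a parity, so they form an
    independent set too large to lie in \<open>D\<close>.\<close>
  have nbr: "\<exists>y. (x, y) \<in> qadj \<and> y \<in> qverts m - D" if xq: "x \<in> qverts m" for x
  proof (rule ccontr)
    assume none: "\<not> ?thesis"
    obtain p a where x: "x = (p, a)" "a \<in> bh_verts m" using xq by (auto simp: qverts_def)
    let ?N = "Pair (\<not> p) ` {b. shifted (sgn_of p) a b}"
    have "?N \<subseteq> D" using none x by (auto simp: qverts_def intro: shifted_in_bh_verts)
    moreover have "indep_set qadj ?N" by (rule indep_set_same_parity[of _ "\<not> p"]) auto
    ultimately have "card ?N \<le> m" by (rule alpha)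
    moreover have "card ?N = Suc m"
      using card_shifted(2)[OF sgn_of_cases x(2)] by (simp add: card_image inj_on_def)
    ultimately show False by simp
  qed
  have adj: "(a, b) \<in> reach ?E S" if "a \<in> S" "b \<in> S" "(cls a, cls b) \<in> qadj" for a b
    using that by (intro reach_step) (auto simp: parcs_BH S_def)
  have qsym: "(y, x) \<in> qadj" if "(x, y) \<in> qadj" "x \<in> qverts m - D" for x y
    using that qadj_sym by blast
  have reach: "(a, c) \<in> reach ?E S"
    if a: "a \<in> S" and "(cls a, q) \<in> reach qadj (qverts m - D)" "c \<in> S" "cls c = q" for a c q
    using that(2-4) unfolding reach_def[of qadj]
  proof (induction arbitrary: c rule: rtrancl_induct)
    case base
    \<comment> \<open>Here \<open>a\<close> and \<open>c\<close> are equal or twins; twins are not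
      adjacent, so the walk passes through a common neighbour.\<close>
    obtain y where y: "(cls a, y) \<in> qadj" "y \<in> qverts m - D" using nbr clsS[OF a] by blast
    then obtain d where d: "d \<in> S" "cls d = y" using lift by blast
    have "(a, d) \<in> reach ?E S" using a d y by (intro adj) auto
    moreover have "(d, c) \<in> reach ?E S"
      using base d y qsym[OF y(1) clsS[OF a]] by (intro adj) auto
    ultimately show ?case by (rule reach_trans)
  next
    case (step y z)
    then obtain d where d: "d \<in> S" "cls d = y" using lift by blast
    have "(d, c) \<in> reach ?E S" using step d by (intro adj) auto
    then show ?case by (rule reach_trans[OF step.IH[OF d]])
  qed
  have S_conn: "(a, c) \<in> reach ?E S" if "a \<in> S" "c \<in> S" for a c
  proof (rule reach[OF that(1) _ that(2) refl])
    show "(cls a, cls c) \<in> reach qadj (qverts m - D)"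
      using alpha clsS that by (intro quotient_connected) (auto simp: D_def)
  qed
  have "replicate m 0 \<in> bh_verts m" by (auto simp: bh_verts_def)
  then obtain x where "x \<in> qverts m - D" using nbr[of "(True, replicate m 0)"] by (auto simp: qverts_def)
  then obtain a where a: "a \<in> S" using lift by blast
  obtain y where y: "(cls a, y) \<in> qadj" "y \<in> qverts m - D" using nbr clsS[OF a] by blast
  then obtain d where d: "d \<in> S" "cls d = y" using lift by blast
  \<comment> \<open>Two remaining vertices rule out the trivial graph, which would also count as
    cut.\<close>
  have "a \<noteq> d" using y(1) d(2) by (auto simp: cls_def)
  then have "card S \<noteq> 1" using a d(1) by (auto simp: card_1_singleton_iff)
  moreover have "connected (with_proj (BH (Suc m)) \<restriction> S)"
    using S_conn a by (auto simp: connected_induce_iff[OF sym_parcs_BH])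
  moreover have "verts (with_proj (BH (Suc m)) \<restriction> S) = S" by (simp add: induce_subgraph_def)
  ultimately show False
    using assms(2) by (simp add: structure_cut_def subgraph_cut_def Let_def S_def U_def)
qed

section \<open>Explicit 4-cycles and the upper bound\<close>

definition four_cycle :: "'a \<Rightarrow> 'a \<Rightarrow> 'a \<Rightarrow> 'a \<Rightarrow> 'a pair_pre_digraph" where
  "four_cycle w x y z = \<lparr> pverts = {w, x, y, z},
     parcs = {(w, x), (x, w), (x, y), (y, x), (y, z), (z, y), (z, w), (w, z)} \<rparr>"

lemma sym_four_cycle: "sym (parcs (four_cycle w x y z))"
  by (auto simp: four_cycle_def sym_def)

lemma pair_graph_four_cycle:
  assumes "distinct [w, x, y, z]"
  shows "pair_graph (four_cycle w x y z)"
  using assms sym_four_cycle[of w x y z]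
  by unfold_locales (auto simp: four_cycle_def symmetric_def)

lemma connected_four_cycle: "connected (with_proj (four_cycle w x y z))"
proof -
  have "(u, v) \<in> (parcs (four_cycle w x y z))\<^sup>*"
    if "u \<in> {w, x, y, z}" "v \<in> {w, x, y, z}" for u v
  proof -
    let ?r = "parcs (four_cycle w x y z)"
    \<comment> \<open>Any two vertices of the cycle are at distance at most two.\<close>
    have "(u, v) \<in> Id \<union> ?r \<union> ?r O ?r" using that by (auto simp: four_cycle_def)
    then show ?thesis by (auto intro: rtrancl_trans)
  qed
  then show ?thesis
    unfolding connected_conv with_proj_simps symcl_sym[OF sym_four_cycle]
    by (auto simp: four_cycle_def intro!: rtrancl_consistent_rtrancl_on)
qed

lemma four_cycle_iso_C4:
  assumes "distinct [w, x, y, z]"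
  shows "digraph_iso (with_proj (four_cycle w x y z)) (with_proj C4)"
proof -
  define g :: "'a \<Rightarrow> nat" where
    "g v = (if v = w then 0 else if v = x then 1 else if v = y then 2 else 3)" for v
  have g: "g w = 0" "g x = 1" "g y = 2" "g z = 3" using assms by (auto simp: g_def)
  define f where "f = \<lparr> iso_verts = g, iso_arcs = map_prod g g, iso_head = snd, iso_tail = fst \<rparr>"
  interpret pair_graph "four_cycle w x y z" using assms by (rule pair_graph_four_cycle)
  have inj: "inj_on g {w, x, y, z}" using g by (auto simp: inj_on_def)
  have "inj_on (map_prod g g) (parcs (four_cycle w x y z))"
    by (rule inj_on_subset[OF map_prod_inj_on[OF inj inj]]) (auto simp: four_cycle_def)
  then have "pre_digraph.digraph_isomorphism (with_proj (four_cycle w x y z)) f"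
    using inj wf_digraph_axioms
    by (auto simp: pre_digraph.digraph_isomorphism_def f_def) (simp add: four_cycle_def)
  moreover have "with_proj C4 = app_iso f (with_proj (four_cycle w x y z))"
    using g by (simp add: app_iso_def with_proj_def C4_def four_cycle_def f_def)
  ultimately show ?thesis unfolding digraph_iso_def by blast
qed

lemma shifted_refl: "shifted s a a"
  by (simp add: shifted_iff)

text \<open>The twins to be isolated are \<open>0 # z\<close> and \<open>2 # z\<close>;
  \<open>N\<close> lists the tails of their odd neighbour classes.\<close>

lemma ex_structure_cut_C4_BH:
  assumes "m \<ge> 1"
  shows "\<exists>F. finite F \<and> structure_cut (BH (Suc m)) C4 F \<and> card F \<le> Suc m"
proof -
  let ?V = "bh_verts (Suc m)" and ?E = "parcs (BH (Suc m))"
  define z where "z = replicate m (0 :: int)"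
  define N where "N = {b. shifted 1 z b}"
  \<comment> \<open>The partner class of \<open>b\<close> must be even, adjacent to \<open>b\<close>
    and different from \<open>z\<close>. The tail \<open>b\<close> itself serves unless
    \<open>b = z\<close>; then the entry 3 shifts to 0, which requires a coordinate and hence
    \<open>m \<ge> 1\<close>.\<close>
  define c where "c b = (if b = z then 3 # replicate (m - 1) 0 else b)" for b
  define cyc where "cyc b = four_cycle (0 # c b) (1 # b) (2 # c b) (3 # b)" for b
  define F where "F = cyc ` N"
  define U where "U = (\<Union>K \<in> F. pverts K)"
  have z: "z \<in> bh_verts m" "z = 0 # replicate (m - 1) 0"
    using assms by (auto simp: z_def bh_verts_def replicate_Suc[symmetric] simp del: replicate_Suc)
  have N: "finite N" "card N = Suc m" using card_shifted[of 1, OF _ z(1)] by (auto simp: N_def)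
  have NV: "b \<in> bh_verts m" if "b \<in> N" for b
    using that z(1) by (auto simp: N_def intro: shifted_in_bh_verts)
  have c: "c b \<in> bh_verts m" "c b \<noteq> z" "shifted 1 (c b) b" if "b \<in> N" for b
    using NV[OF that] z assms
    by (auto simp: c_def shifted_refl bh_verts_def)
  have subset: "(\<Union>K \<in> F. pverts K) \<subseteq> ?V"
    using c NV by (auto simp: F_def cyc_def four_cycle_def)
  have arcs: "parcs (cyc b) \<subseteq> ?E" if "b \<in> N" for b
    using c[OF that] NV[OF that] shifted_sym[OF c(3)[OF that] c(1)[OF that]]
    by (auto simp: cyc_def four_cycle_def parcs_BH sgn_of_def)
  have wf: "wf_digraph (with_proj (BH (Suc m)))"
    by unfold_locales (auto simp: parcs_BH)
  have graph: "pair_graph (cyc b)" for b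
    unfolding cyc_def by (rule pair_graph_four_cycle) simp
  have elem: "pair_graph K \<and> subgraph (with_proj K) (with_proj (BH (Suc m))) \<and> connected (with_proj K)
      \<and> digraph_iso (with_proj K) (with_proj C4)" if KF: "K \<in> F" for K
  proof -
    obtain b where b: "b \<in> N" "K = cyc b" using KF by (auto simp: F_def)
    interpret pair_graph K using graph b by simp
    have "subgraph (with_proj K) (with_proj (BH (Suc m)))"
      using arcs b subset KF wf wf_digraph_axioms by (auto simp: subgraph_def)
    moreover have "connected (with_proj K)" "digraph_iso (with_proj K) (with_proj C4)"
      unfolding b(2) cyc_def by (rule connected_four_cycle) (rule four_cycle_iso_C4, simp)
    ultimately show ?thesis using pair_graph by blast
  qed
  have out: "x # z \<in> ?V - U" if "x \<in> {0, 2}" for x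
    using that z(1) c(2) by (auto simp: U_def F_def cyc_def four_cycle_def)
  have "(0 # z, 2 # z) \<notin> reach ?E (?V - U)"
  proof
    assume "(0 # z, 2 # z) \<in> reach ?E (?V - U)"
    \<comment> \<open>The ends differ, so a walk has a first step, to an odd vertex with tail in
      \<open>N\<close>; all such vertices lie on the cycles.\<close>
    then obtain d where d: "(0 # z, d) \<in> ?E" "d \<notin> U"
      unfolding reach_def by (cases rule: converse_rtranclE) auto
    then obtain x b where xb: "d = x # b" "x \<in> {0, 1, 2, 3}" "odd x" "b \<in> N"
      by (auto simp: parcs_BH N_def sgn_of_def elim!: bh_verts_SucE)
    then show False using d(2) by (auto simp: U_def F_def cyc_def four_cycle_def)
  qed
  then have "\<not> connected (with_proj (BH (Suc m)) \<restriction> (?V - U))"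
    using out[of 0] out[of 2] unfolding connected_induce_iff[OF sym_parcs_BH] by blast
  then have "structure_cut (BH (Suc m)) C4 F"
    using elem by (simp add: structure_cut_def subgraph_cut_def Let_def U_def)
  moreover have "finite F" "card F \<le> Suc m" using N card_image_le[OF N(1), of cyc] by (simp_all add: F_def)
  ultimately show ?thesis by blast
qed

theorem theorem7:
  fixes n :: nat
  assumes "n \<ge> 2"
  shows "structure_connectivity (BH n) C4 = enat n"
proof -
  obtain m where m: "n = Suc m" "m \<ge> 1" using assms by (cases n) auto
  obtain F where F: "finite F" "structure_cut (BH n) C4 F" "card F \<le> n"
    using ex_structure_cut_C4_BH[OF m(2)] m(1) by auto
  show ?thesis unfolding structure_connectivity_def
  proof (rule antisym)
    show "(INF F \<in> {F. finite F \<and> structure_cut (BH n) C4 F}. enat (card F)) \<le> enat n"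
      using F by (intro INF_lower2[of F]) auto
    show "enat n \<le> (INF F \<in> {F. finite F \<and> structure_cut (BH n) C4 F}. enat (card F))"
      using structure_cut_C4_BH_card_ge m(1) by (intro INF_greatest) auto
  qed
qed

end
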